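(* Let $X$ be a finite set and let $N \ge 2$ be an integer. Let $$\tilde\Gamma_2 = \left\{ \frac{N}{N-1}\lambda\lambda^T - \frac{1}{N-1}\operatorname{diag}^*(\lambda) \ \Big|\ \lambda \in \mathcal{B}_N(X)\right\}$$ and $$D = \left\{ \frac{N}{N-1}\Lambda - \frac{1}{N-1}\operatorname{diag}^*(\Lambda\mathbf{1}) \ \Big|\ \Lambda \in \mathbb{R}^{|X|\times|X|},\ \Lambda \succeq 0,\ \Lambda \ge 0,\ \mathbf{1}^T\Lambda\mathbf{1} = 1,\ \operatorname{diag}(\Lambda) = \frac{1}{N}\Lambda\mathbf{1}\right\}.$$ Then $\tilde\Gamma_2$ is a subset of the set of extreme points of $D$.
   Context: The elements of $X$ are identified with $1,\dots,|X|$. The set of binarized probability vectors is $$\mathcal{B}_N(X) = \{\lambda\in\mathbb{R}^{|X|} \mid \lambda^T\mathbf{1} = 1,\ \lambda(i)\in\{0,1/N\},\ i=1,\dots,|X|\}.$$ $\mathbf{1}$ is the all-ones vector. For a square matrix $A$, $\operatorname{diag}(A)$ is the vector of its diagonal entries; $\operatorname{diag}^*$ is the adjoint of $\operatorname{diag}$, i.e. $\operatorname{diag}^*(v)$ is the diagonal matrix with diagonal $v$. $\Lambda\succeq 0$ means that $\Lambda$ is symmetric positive semidefinite, and $\Lambda\ge 0$ means that all entries of $\Lambda$ are nonnegative. The set $D$ is the feasible set, in the variable $\gamma$, of the semidefinite relaxation in variables $(\gamma,\Lambda)$ with constraints $\gamma = \frac{N}{N-1}\Lambda - \frac{1}{N-1}\operatorname{diag}^*(\Lambda\mathbf{1})$,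 $\Lambda\succeq 0$, $\Lambda\ge 0$, $\mathbf{1}^T\Lambda\mathbf{1}=1$, $\operatorname{diag}(\Lambda)=\frac1N\Lambda\mathbf{1}$ (no further linear constraint on $\Lambda\mathbf{1}$). *)

theory Defs
  imports "HOL-Analysis.Analysis"
begin

text \<open>
  The finite set \<open>X\<close> is the index type \<open>'n\<close>, and \<open>1 :: real ^ 'n\<close> is the all-ones vector.
\<close>

definition diag_vec :: "real ^ 'n ^ 'n \<Rightarrow> real ^ 'n" where
  "diag_vec A = (\<chi> i. A $ i $ i)"

definition diag_star :: "real ^ 'n \<Rightarrow> real ^ 'n ^ 'n" where
  "diag_star v = (\<chi> i j. if i = j then v $ i else 0)"

lemma adjoint_diag_vec: "adjoint diag_vec = diag_star"
proof (rule adjoint_unique, intro allI)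
  fix A :: "real ^ 'n ^ 'n" and v :: "real ^ 'n"
  have "A $ i \<bullet> diag_star v $ i = A $ i $ i * v $ i" for i
    by (simp add: inner_vec_def diag_star_def if_distrib cong: if_cong)
  moreover have "diag_vec A \<bullet> v = (\<Sum>i\<in>UNIV. A $ i $ i * v $ i)"
    by (simp add: inner_vec_def diag_vec_def)
  ultimately show "diag_vec A \<bullet> v = A \<bullet> diag_star v"
    by (simp add: inner_vec_def[of A])
qed

definition sym_psd :: "real ^ 'n ^ 'n \<Rightarrow> bool" where
  "sym_psd A \<longleftrightarrow> transpose A = A \<and> (\<forall>x. 0 \<le> x \<bullet> (A *v x))"

definition entrywise_nonneg :: "real ^ 'n ^ 'n \<Rightarrow> bool" where
  "entrywise_nonneg A \<longleftrightarrow> (\<forall>i j. 0 \<le> A $ i $ j)"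

definition outer_prod :: "real ^ 'n \<Rightarrow> real ^ 'n \<Rightarrow> real ^ 'n ^ 'n" where
  "outer_prod u v = (\<chi> i j. u $ i * v $ j)"

definition binarized :: "nat \<Rightarrow> (real ^ 'n) set" where
  "binarized N = {l. l \<bullet> 1 = 1 \<and> (\<forall>i. l $ i \<in> {0, 1 / real N})}"

definition Gamma2 :: "nat \<Rightarrow> (real ^ 'n ^ 'n) set" where
  "Gamma2 N =
    {(real N / (real N - 1)) *\<^sub>R outer_prod l l - (1 / (real N - 1)) *\<^sub>R diag_star l | l.
      l \<in> binarized N}"

definition relaxed_set :: "nat \<Rightarrow> (real ^ 'n ^ 'n) set" where
  "relaxed_set N =
    {(real N / (real N - 1)) *\<^sub>R L - (1 / (real N - 1)) *\<^sub>R diag_star (L *v 1) | L.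
      sym_psd L \<and> entrywise_nonneg L \<and> 1 \<bullet> (L *v 1) = 1 \<and>
      diag_vec L = (1 / real N) *\<^sub>R (L *v 1)}"

end

theory Submission
  imports Defs
begin

text \<open>
  The map \<open>\<Lambda> \<mapsto> (N \<Lambda> - diag\<^sup>*(\<Lambda> 1)) / (N - 1)\<close> that parametrizes \<open>D\<close> is linear, and for
  \<open>N \<ge> 2\<close> it is injective: off the diagonal it only scales, and once the off-diagonal entries of
  \<open>\<Lambda>\<close> vanish it fixes the diagonal (\<open>inj_marginal_map\<close>). Injective linear maps carry extreme
  points to extreme points, so it is enough that \<open>\<lambda> \<lambda>\<^sup>T\<close> is an extreme point of the set of feasible
  \<open>\<Lambda>\<close>.

  Suppose \<open>\<lambda> \<lambda>\<^sup>T\<close> is a proper convex combination of feasible \<open>A\<close> and \<open>B\<close>, and let \<open>S\<close> be the support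
  of \<open>\<lambda>\<close>, which has \<open>N\<close> elements. Any linear functional that is nonnegative on feasible matrices and
  vanishes at \<open>\<lambda> \<lambda>\<^sup>T\<close> vanishes at \<open>A\<close> and \<open>B\<close>. The entries outside \<open>S \<times> S\<close> are such functionals,
  and so are the quadratic forms at \<open>e\<^sub>i - e\<^sub>j\<close> with \<open>i, j \<in> S\<close>. Hence \<open>A\<close> lives on \<open>S \<times> S\<close> and
  \<open>A\<^sub>i\<^sub>i + A\<^sub>j\<^sub>j = 2 A\<^sub>i\<^sub>j\<close> there. Summing over \<open>j \<in> S\<close> and using \<open>(A 1)\<^sub>i = N A\<^sub>i\<^sub>i\<close> gives
  \<open>N A\<^sub>i\<^sub>i + tr A = 2 N A\<^sub>i\<^sub>i\<close>, while \<open>tr A = 1 / N\<close>; so every entry on \<open>S \<times> S\<close> is \<open>1 / N\<^sup>2\<close>, that is,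
  \<open>A = \<lambda> \<lambda>\<^sup>T\<close> (\<open>feasible_eq_outer_prod\<close>). The same holds for \<open>B\<close>, so the combination was not proper.
\<close>

definition marginal_map :: "nat \<Rightarrow> real ^ 'n ^ 'n \<Rightarrow> real ^ 'n ^ 'n" where
  "marginal_map N L =
    (real N / (real N - 1)) *\<^sub>R L - (1 / (real N - 1)) *\<^sub>R diag_star (L *v 1)"

definition feasible :: "nat \<Rightarrow> (real ^ 'n ^ 'n) set" where
  "feasible N = {L. sym_psd L \<and> entrywise_nonneg L \<and> 1 \<bullet> (L *v 1) = 1 \<and>
      diag_vec L = (1 / real N) *\<^sub>R (L *v 1)}"

lemma relaxed_set_eq_image: "relaxed_set N = marginal_map N ` feasible N"
  unfolding relaxed_set_def marginal_map_def feasible_def by auto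

lemma matrix_vector_one: "(A *v 1) $ i = (\<Sum>j\<in>UNIV. A $ i $ j)"
  for A :: "real ^ 'n ^ 'm"
  by (simp add: matrix_vector_mult_def)

lemma linear_marginal_map: "linear (marginal_map N)"
  by (rule linearI)
    (simp_all add: marginal_map_def diag_star_def vec_eq_iff matrix_vector_one sum.distrib
      sum_distrib_left[symmetric] algebra_simps add_divide_distrib)

lemma inj_marginal_map:
  assumes "N \<ge> 2"
  shows "inj (marginal_map N :: real ^ 'n ^ 'n \<Rightarrow> real ^ 'n ^ 'n)"
proof (subst linear_injective_0[OF linear_marginal_map], intro allI impI)
  fix L :: "real ^ 'n ^ 'n"
  assume L: "marginal_map N L = 0"
  have N: "real N - 1 > 0" using assms by simp
  have entry: "real N * L $ i $ j = (if i = j then \<Sum>k\<in>UNIV. L $ i $ k else 0)" for i j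
  proof -
    have "(real N * L $ i $ j - (if i = j then \<Sum>k\<in>UNIV. L $ i $ k else 0)) / (real N - 1)
        = marginal_map N L $ i $ j"
      by (simp add: marginal_map_def diag_star_def matrix_vector_one diff_divide_distrib)
    then show ?thesis using N L by simp
  qed
  have off: "L $ i $ j = 0" if "i \<noteq> j" for i j
    using entry[of i j] that assms by simp
  have "L $ i $ i = 0" for i
  proof -
    have "(\<Sum>k\<in>UNIV. L $ i $ k) = (\<Sum>k\<in>UNIV. if k = i then L $ i $ i else 0)"
      by (rule sum.cong) (auto simp: off)
    then have "(real N - 1) * L $ i $ i = 0"
      using entry[of i i] by (simp add: algebra_simps)
    then show ?thesis using N by simp
  qed
  then show "L = 0"
    using off by (metis vec_eq_iff zero_index)
qed

lemma outer_prod_mult_vec: "outer_prod u v *v x = (v \<bullet> x) *\<^sub>R u"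
  by (simp add: vec_eq_iff outer_prod_def matrix_vector_mult_def inner_vec_def
      sum_distrib_left mult_ac)

lemma quadratic_form_axis_diff:
  fixes A :: "real ^ 'n ^ 'n"
  shows "(axis i 1 - axis j 1) \<bullet> (A *v (axis i 1 - axis j 1)) =
    A $ i $ i - A $ i $ j - A $ j $ i + A $ j $ j"
  by (simp add: matrix_vector_mult_diff_distrib matrix_vector_mul_component inner_diff_left
      inner_axis inner_axis' matrix_vector_mult_basis column_def)

lemma binarized_sum:
  assumes "l \<in> binarized N"
  shows "(\<Sum>i\<in>UNIV. l $ i) = 1"
  using assms by (simp add: binarized_def inner_vec_def)

text \<open>
  For \<open>N = 0\<close> the value \<open>1 / N\<close> is \<open>0\<close>, so that every candidate vector has sum \<open>0\<close>.
\<close>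

lemma binarized_pos:
  assumes "l \<in> binarized N"
  shows "0 < N"
proof (rule ccontr)
  assume "\<not> 0 < N"
  then have "l = 0"
    using assms by (simp add: binarized_def vec_eq_iff)
  then show False using binarized_sum[OF assms] by simp
qed

lemma binarized_card_support:
  assumes l: "l \<in> binarized N"
  shows "card {i. l $ i \<noteq> 0} = N"
proof -
  define S where "S = {i. l $ i \<noteq> 0}"
  have "1 = (\<Sum>i\<in>UNIV. l $ i)" using binarized_sum[OF l] by simp
  also have "\<dots> = (\<Sum>i\<in>S. l $ i)"
    by (rule sum.mono_neutral_right) (auto simp: S_def)
  also have "\<dots> = (\<Sum>i\<in>S. 1 / real N)"
    using l by (intro sum.cong) (auto simp: S_def binarized_def)
  also have "\<dots> = real (card S) / real N" by simp
  finally have "real (card S) = real N"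
    using binarized_pos[OF l] by (simp only: field_simps of_nat_0_less_iff)
  then show ?thesis by (simp add: S_def)
qed

lemma marginal_map_outer_prod:
  assumes "l \<in> binarized N"
  shows "marginal_map N (outer_prod l l) =
    (real N / (real N - 1)) *\<^sub>R outer_prod l l - (1 / (real N - 1)) *\<^sub>R diag_star l"
  using assms by (simp add: marginal_map_def outer_prod_mult_vec binarized_def)

lemma outer_prod_feasible:
  assumes l: "l \<in> binarized N"
  shows "outer_prod l l \<in> feasible N"
proof -
  have vals: "l $ i = 0 \<or> l $ i = 1 / real N" and one: "l \<bullet> 1 = 1" for i
    using l by (auto simp: binarized_def)
  have nonneg: "0 \<le> l $ i" for i
    using vals[of i] by auto
  have sq: "l $ i * l $ i = 1 / real N * l $ i" for i
    using vals[of i] by auto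
  show ?thesis
    using one sq nonneg
    by (auto simp: feasible_def sym_psd_def entrywise_nonneg_def outer_prod_mult_vec inner_commute
        diag_vec_def vec_eq_iff)
      (auto simp: outer_prod_def transpose_def vec_eq_iff)
qed

text \<open>
  The hypothesis \<open>diff\<close> makes each off-diagonal entry on the support the mean of two diagonal
  entries, so the constraint \<open>diag(A) = A 1 / N\<close> becomes a linear system in the diagonal alone.
  Because the support has exactly \<open>N\<close> elements, averaging the entries of a row leaves half the
  weight on its diagonal entry and half on the mean of all of them, which forces these to be equal.
\<close>

lemma feasible_eq_outer_prod:
  fixes A :: "real ^ 'n ^ 'n"
  assumes A: "A \<in> feasible N" and l: "l \<in> binarized N"
    and supp: "\<And>i j. l $ i * l $ j = 0 \<Longrightarrow> A $ i $ j = 0"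
    and diff: "\<And>i j. l $ i \<noteq> 0 \<Longrightarrow> l $ j \<noteq> 0 \<Longrightarrow>
      (axis i 1 - axis j 1) \<bullet> (A *v (axis i 1 - axis j 1)) = 0"
  shows "A = outer_prod l l"
proof -
  define S where "S = {i. l $ i \<noteq> 0}"
  have card: "card S = N" unfolding S_def by (rule binarized_card_support[OF l])
  have N: "real N > 0" using binarized_pos[OF l] by simp
  have lS: "l $ i = 1 / real N" if "i \<in> S" for i
    using that l by (auto simp: S_def binarized_def)
  have sym: "A $ j $ i = A $ i $ j" for i j
    using A unfolding feasible_def sym_psd_def
    by (metis (mono_tags, lifting) mem_Collect_eq transpose_def vec_lambda_beta)
  have sum_S: "(\<Sum>j\<in>UNIV. A $ i $ j) = (\<Sum>j\<in>S. A $ i $ j)" for i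
    by (rule sum.mono_neutral_right) (auto simp: S_def supp)
  have row: "(\<Sum>j\<in>UNIV. A $ i $ j) = real N * A $ i $ i" for i
  proof -
    have "diag_vec A $ i = (1 / real N) * (A *v 1) $ i"
      using A by (simp add: feasible_def)
    then show ?thesis using N by (simp add: diag_vec_def matrix_vector_one)
  qed
  have "(\<Sum>i\<in>UNIV. \<Sum>j\<in>UNIV. A $ i $ j) = 1"
    using A by (simp add: feasible_def inner_vec_def matrix_vector_one)
  then have "real N * (\<Sum>i\<in>UNIV. A $ i $ i) = 1"
    by (simp add: row sum_distrib_left)
  moreover have "(\<Sum>i\<in>UNIV. A $ i $ i) = (\<Sum>i\<in>S. A $ i $ i)"
    by (rule sum.mono_neutral_right) (auto simp: S_def supp)
  ultimately have trace: "(\<Sum>i\<in>S. A $ i $ i) = 1 / real N"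
    using N by (simp add: field_simps)
  have pair: "A $ i $ i + A $ j $ j = 2 * A $ i $ j" if "i \<in> S" "j \<in> S" for i j
    using diff[of i j] that by (simp add: S_def quadratic_form_axis_diff sym[of i j])
  have diag: "A $ i $ i = 1 / (real N)\<^sup>2" if "i \<in> S" for i
  proof -
    have "real N * A $ i $ i + (\<Sum>j\<in>S. A $ j $ j) = (\<Sum>j\<in>S. A $ i $ i + A $ j $ j)"
      by (simp add: sum.distrib card)
    also have "\<dots> = 2 * (\<Sum>j\<in>S. A $ i $ j)"
      by (simp add: pair[OF that] sum_distrib_left)
    also have "\<dots> = 2 * (real N * A $ i $ i)"
      using row[of i] sum_S[of i] by simp
    finally show ?thesis
      using N by (simp add: trace field_simps power2_eq_square)
  qed
  have "A $ i $ j = l $ i * l $ j" for i j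
  proof (cases "i \<in> S \<and> j \<in> S")
    case True
    then show ?thesis
      using pair[of i j] diag lS by (simp add: power2_eq_square)
  next
    case False
    then show ?thesis
      using supp[of i j] by (auto simp: S_def)
  qed
  then show ?thesis
    by (simp add: vec_eq_iff outer_prod_def)
qed

lemma convex_combination_nonneg_eq_0:
  fixes a b u :: real
  assumes "0 \<le> a" "0 \<le> b" "0 < u" "u < 1" "(1 - u) * a + u * b = 0"
  shows "a = 0" "b = 0"
proof -
  have "0 \<le> (1 - u) * a" "0 \<le> u * b" using assms by simp_all
  then have "(1 - u) * a = 0" "u * b = 0" using assms(5) by linarith+
  then show "a = 0" "b = 0" using assms(3,4) by simp_all
qed

lemma outer_prod_extreme_point_of_feasible:
  fixes l :: "real ^ 'n"
  assumes l: "l \<in> binarized N"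
  shows "outer_prod l l extreme_point_of feasible N"
  unfolding extreme_point_of_def
proof (intro conjI ballI notI)
  show "outer_prod l l \<in> feasible N" by (rule outer_prod_feasible[OF l])
next
  fix A B :: "real ^ 'n ^ 'n"
  assume A: "A \<in> feasible N" and B: "B \<in> feasible N"
    and "outer_prod l l \<in> open_segment A B"
  then obtain u where AB: "A \<noteq> B" and u: "0 < u" "u < 1"
    and eq: "outer_prod l l = (1 - u) *\<^sub>R A + u *\<^sub>R B"
    by (auto simp: in_segment)
  have entries: "0 \<le> A $ i $ j" "0 \<le> B $ i $ j" for i j
    using A B by (auto simp: feasible_def entrywise_nonneg_def)
  have forms: "0 \<le> x \<bullet> (A *v x)" "0 \<le> x \<bullet> (B *v x)" for x
    using A B by (auto simp: feasible_def sym_psd_def)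
  have supp: "A $ i $ j = 0" "B $ i $ j = 0" if "l $ i * l $ j = 0" for i j
  proof -
    have "outer_prod l l $ i $ j = (1 - u) * A $ i $ j + u * B $ i $ j"
      unfolding eq by simp
    then have "(1 - u) * A $ i $ j + u * B $ i $ j = 0"
      using that by (simp add: outer_prod_def)
    from convex_combination_nonneg_eq_0[OF entries u this]
    show "A $ i $ j = 0" "B $ i $ j = 0" by auto
  qed
  have form0: "x \<bullet> (A *v x) = 0" "x \<bullet> (B *v x) = 0" if "l \<bullet> x = 0" for x
  proof -
    have "x \<bullet> (outer_prod l l *v x) = (1 - u) * (x \<bullet> (A *v x)) + u * (x \<bullet> (B *v x))"
      unfolding eq
      by (simp add: matrix_vector_mult_add_rdistrib scaleR_matrix_vector_assoc[symmetric]
          inner_add_right)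
    then have "(1 - u) * (x \<bullet> (A *v x)) + u * (x \<bullet> (B *v x)) = 0"
      using that by (simp add: outer_prod_mult_vec)
    from convex_combination_nonneg_eq_0[OF forms u this]
    show "x \<bullet> (A *v x) = 0" "x \<bullet> (B *v x) = 0" by auto
  qed
  have orth: "l \<bullet> (axis i 1 - axis j 1) = 0" if "l $ i \<noteq> 0" "l $ j \<noteq> 0" for i j
  proof -
    have "l $ k = 0 \<or> l $ k = 1 / real N" for k using l by (simp add: binarized_def)
    then have "l $ i = l $ j" using that by metis
    then show ?thesis by (simp add: inner_diff_right inner_axis)
  qed
  have "A = outer_prod l l"
    by (rule feasible_eq_outer_prod[OF A l]) (simp_all add: supp form0 orth)
  moreover have "B = outer_prod l l"
    by (rule feasible_eq_outer_prod[OF B l]) (simp_all add: supp form0 orth)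
  ultimately show False using AB by simp
qed

theorem theorem2:
  fixes N :: nat
  assumes "N \<ge> 2"
  shows "(Gamma2 N :: (real ^ 'n ^ 'n) set) \<subseteq>
    {x. x extreme_point_of (relaxed_set N :: (real ^ 'n ^ 'n) set)}"
proof
  fix x :: "real ^ 'n ^ 'n"
  assume "x \<in> Gamma2 N"
  then obtain l where l: "l \<in> binarized N" and x: "x = marginal_map N (outer_prod l l)"
    unfolding Gamma2_def by (auto simp: marginal_map_outer_prod)
  have "marginal_map N (outer_prod l l) extreme_point_of (marginal_map N ` feasible N)"
    using face_of_linear_image[OF linear_marginal_map inj_marginal_map[OF assms],
        of "{outer_prod l l}" "feasible N"]
      outer_prod_extreme_point_of_feasible[OF l]
    by (simp add: face_of_singleton)
  then show "x \<in> {x. x extreme_point_of relaxed_set N}"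
    by (simp add: x relaxed_set_eq_image)
qed

end
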